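(* Let $p\in(0,1)$ and $L>0$. Cut a stick of length $L$ at proportion $p$ into two pieces (of lengths $Lp$ and $L(1-p)$); then cut each resulting piece at the same proportion $p$; and so on. After $N$ stages this yields $2^N$ sticks, with lengths (which are $N+1$ distinct numbers if $p\ne 1/2$) $$x_1=Lp^N,\quad x_2=Lp^{N-1}(1-p),\quad x_3=Lp^{N-2}(1-p)^2,\ \dots,\ x_N=Lp(1-p)^{N-1},\quad x_{N+1}=L(1-p)^N,$$ where $x_n=Lp^{N-n+1}(1-p)^{n-1}$ has frequency $\binom{N}{n-1}/2^N$. Define $y\in\mathbb{R}$ by $10^y=(1-p)/p$, and let $$P_N(s)=\frac{1}{2^N}\sum_{n=1}^{N+1}\binom{N}{n-1}\varphi_s(x_n),\qquad s\in[1,10).$$ Then the stick lengths converge in distribution to Benford's Law as $N\to\infty$ (i.e. $\lim_{N\to\infty}P_N(s)=\log_{10}s$ for every $s\in[1,10)$) if and only if $y\notin\mathbb{Q}$. Moreover, if $y\notin\mathbb{Q}$ has finite irrationality exponent $\kappa$, then the rate of convergence can be quantified in terms of $\kappa$ with a power savings: there is $\eta>0$ depending only on $\kappa$ such that for every $s\in[1,10)$, $$P_N(s)=\log_{10}s+O(N^{-\eta})\qquad (N\to\infty).$$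
   Context: Every $x>0$ is written uniquely as $x=S_{10}(x)\cdot 10^{k}$ with $k\in\mathbb{Z}$ and significand $S_{10}(x)\in[1,10)$. For $s\in[1,10)$, $\varphi_s(x)=1$ if $S_{10}(x)\le s$ and $\varphi_s(x)=0$ otherwise. A number $\alpha$ has irrationality exponent $\kappa$ if $\kappa$ is the supremum of all $\gamma$ with $$\liminf_{q\to\infty}\ q^{\gamma+1}\min_{a\in\mathbb{Z}}\left|\alpha-\frac{a}{q}\right|=0,$$ where $q$ ranges over the positive integers. (With this normalization every algebraic irrational has irrationality exponent $1$.) *)

theory Defs
  imports Complex_Main "HOL-Library.Multiset" "HOL-Library.Extended_Real"
    "HOL-Library.Landau_Symbols"
begin

definition significand10 :: "real \<Rightarrow> real" where
  "significand10 x = (THE s. 1 \<le> s \<and> s < 10 \<and> (\<exists>k::int. x = s * 10 powi k))"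

definition signif_le :: "real \<Rightarrow> real \<Rightarrow> real" where
  "signif_le s x = (if significand10 x \<le> s then 1 else 0)"

text \<open>The lengths after \<open>N\<close> stages of cutting, one entry per stick.\<close>

primrec sticks :: "real \<Rightarrow> real \<Rightarrow> nat \<Rightarrow> real multiset" where
  "sticks p L 0 = {#L#}"
| "sticks p L (Suc N) = (\<Sum>x\<in>#sticks p L N. {#x * p, x * (1 - p)#})"

text \<open>The index \<open>n\<close> ranges over \<open>1, \<dots>, N + 1\<close>; in this range the
  truncated subtractions agree with those on the integers.\<close>

definition stick_length :: "real \<Rightarrow> real \<Rightarrow> nat \<Rightarrow> nat \<Rightarrow> real" where
  "stick_length p L N n = L * p ^ (N + 1 - n) * (1 - p) ^ (n - 1)"

definition stick_cdf :: "real \<Rightarrow> real \<Rightarrow> nat \<Rightarrow> real \<Rightarrow> real" where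
  "stick_cdf p L N s =
     1 / 2 ^ N * (\<Sum>n = 1..N + 1. real (N choose (n - 1)) * signif_le s (stick_length p L N n))"

text \<open>The normalization is the one in which algebraic irrationals have exponent \<open>1\<close>.
  The infimum over the numerators \<open>a\<close> is attained, so it is the minimum; the junk value
  at \<open>q = 0\<close> does not affect the limit inferior. The supremum is taken in the extended
  reals, so that the exponent may be infinite.\<close>

definition irrationality_exponent :: "real \<Rightarrow> ereal" where
  "irrationality_exponent \<alpha> =
     Sup {ereal \<gamma> | \<gamma>.
       liminf (\<lambda>q. ereal (real q powr (\<gamma> + 1) *
         (INF a::int. \<bar>\<alpha> - of_int a / real q\<bar>))) = 0}"

end

theory Submission
  imports Defs "HOL-Analysis.Kronecker_Approximation_Theorem" "HOL-Real_Asymp.Real_Asymp"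
begin

text \<open>
  Since \<open>log 10 x\<^sub>n = c\<^sub>N + (n - 1) y\<close>, the distribution is that of \<open>c\<^sub>N + k y\<close> modulo 1 for
  binomially distributed \<open>k\<close>. Shifting \<open>k\<close> by one changes a binomial mean of a bounded function
  by \<open>O(1 / sqrt N)\<close>, so one may first average over \<open>q\<close> consecutive values of \<open>k\<close> at a cost of
  \<open>O(q / sqrt N)\<close>. If \<open>q\<close> is the denominator of a reduced fraction with
  \<open>\<bar>y - a / q\<bar> \<le> 1 / q\<^sup>2\<close>, then \<open>q\<close> consecutive points are close to the points of a grid of
  mesh \<open>1 / q\<close>, hence equidistributed up to \<open>O(1 / q)\<close>. For irrational \<open>y\<close> such \<open>q\<close> are
  unbounded; if the irrationality exponent is less than \<open>\<gamma>\<close>, Dirichlet's theorem gives one between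
  constant multiples of \<open>N powr (1 / (4 * \<gamma>))\<close> and \<open>N powr (1 / 4)\<close>, whence \<open>\<eta> = 1 / (4 * \<gamma>)\<close>.
  For rational \<open>y\<close> with denominator \<open>q\<close> at most \<open>q\<close> fractional parts occur, and they cannot meet
  \<open>q + 1\<close> disjoint intervals.
\<close>

section \<open>Binomial means and their behaviour under shifts\<close>

definition binomial_mean :: "nat \<Rightarrow> (nat \<Rightarrow> real) \<Rightarrow> real" where
  "binomial_mean n f = (\<Sum>k\<le>n. real (n choose k) * f k) / 2 ^ n"

lemma binomial_mean_mono:
  assumes "\<And>k. f k \<le> g k"
  shows "binomial_mean n f \<le> binomial_mean n g"
  unfolding binomial_mean_def by (intro divide_right_mono sum_mono mult_left_mono assms) auto

lemma binomial_mean_const [simp]: "binomial_mean n (\<lambda>_. c) = c"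
proof -
  have "(\<Sum>k\<le>n. real (n choose k)) = 2 ^ n"
    by (metis choose_row_sum of_nat_numeral of_nat_power of_nat_sum)
  then show ?thesis
    by (simp add: binomial_mean_def flip: sum_distrib_right)
qed

lemma binomial_mean_add:
  "binomial_mean n (\<lambda>k. f k + g k) = binomial_mean n f + binomial_mean n g"
  by (simp add: binomial_mean_def algebra_simps sum.distrib add_divide_distrib)

lemma binomial_mean_cmult: "binomial_mean n (\<lambda>k. c * f k) = c * binomial_mean n f"
  by (simp add: binomial_mean_def sum_distrib_left mult_ac)

lemma binomial_mean_diff:
  "binomial_mean n (\<lambda>k. f k - g k) = binomial_mean n f - binomial_mean n g"
  by (simp add: binomial_mean_def algebra_simps sum_subtractf diff_divide_distrib)

lemma binomial_mean_sum:
  "binomial_mean n (\<lambda>k. \<Sum>j\<in>A. f j k) = (\<Sum>j\<in>A. binomial_mean n (f j))"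
  by (induction A rule: infinite_finite_induct) (simp_all add: binomial_mean_add)

lemma abs_binomial_mean_le: "\<bar>binomial_mean n f\<bar> \<le> binomial_mean n (\<lambda>k. \<bar>f k\<bar>)"
proof -
  have "\<bar>\<Sum>k\<le>n. real (n choose k) * f k\<bar> \<le> (\<Sum>k\<le>n. real (n choose k) * \<bar>f k\<bar>)"
    by (rule order_trans[OF sum_abs]) (simp add: abs_mult)
  then show ?thesis
    by (simp add: binomial_mean_def divide_right_mono)
qed

text \<open>Pascal's rule for any \<open>g\<close> additive in its first argument. This generality
  covers both the real weights in \<open>binomial_mean_Suc\<close> and the multiplicities of
  \<open>replicate_mset\<close> in \<open>sticks_eq\<close>.\<close>

lemma sum_binomial_Suc:
  fixes g :: "nat \<Rightarrow> nat \<Rightarrow> 'a :: comm_monoid_add"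
  assumes "\<And>a b k. g (a + b) k = g a k + g b k" and "\<And>k. g 0 k = 0"
  shows "(\<Sum>k\<le>Suc n. g (Suc n choose k) k)
    = (\<Sum>k\<le>n. g (n choose k) k) + (\<Sum>k\<le>n. g (n choose k) (Suc k))"
proof -
  have "(\<Sum>k\<le>Suc n. g (n choose k) k) = g 1 0 + (\<Sum>k\<le>n. g (n choose Suc k) (Suc k))"
    by (subst sum.atMost_Suc_shift) simp
  moreover have "(\<Sum>k\<le>Suc n. g (n choose k) k) = (\<Sum>k\<le>n. g (n choose k) k)"
    by (simp add: assms(2) binomial_eq_0)
  moreover have "(\<Sum>k\<le>Suc n. g (Suc n choose k) k) =
      g 1 0 + (\<Sum>k\<le>n. g (n choose k) (Suc k)) + (\<Sum>k\<le>n. g (n choose Suc k) (Suc k))"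
    by (subst sum.atMost_Suc_shift) (simp add: assms sum.distrib add_ac)
  ultimately show ?thesis
    by (metis (no_types, lifting) add.assoc add.commute)
qed

lemma binomial_mean_Suc:
  "binomial_mean (Suc n) f = (binomial_mean n f + binomial_mean n (\<lambda>k. f (Suc k))) / 2"
  unfolding binomial_mean_def
  by (subst sum_binomial_Suc) (simp_all add: algebra_simps add_divide_distrib)

text \<open>Induction by Pascal's rule: with \<open>x = 2 * k - n\<close>, passing to row
  \<open>n + 1\<close> averages \<open>(x - 1)^2\<close> and \<open>(x + 1)^2\<close>, which gives
  \<open>x^2 + 1\<close>.\<close>

lemma binomial_mean_variance: "binomial_mean n (\<lambda>k. (2 * real k - real n)\<^sup>2) = real n"
proof (induction n)
  case 0
  show ?case by (simp add: binomial_mean_def)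
next
  case (Suc n)
  have "binomial_mean (Suc n) (\<lambda>k. (2 * real k - real (Suc n))\<^sup>2) =
    binomial_mean n (\<lambda>k. ((2 * real k - real (Suc n))\<^sup>2 + (2 * real (Suc k) - real (Suc n))\<^sup>2)) / 2"
    by (simp only: binomial_mean_Suc binomial_mean_add)
  also have "(\<lambda>k. ((2 * real k - real (Suc n))\<^sup>2 + (2 * real (Suc k) - real (Suc n))\<^sup>2)) =
      (\<lambda>k. 2 * ((2 * real k - real n)\<^sup>2 + 1))"
    by (auto simp: power2_eq_square algebra_simps)
  finally show ?case
    by (simp add: binomial_mean_add binomial_mean_cmult Suc.IH del: of_nat_Suc)
qed

text \<open>The variance bounds the first absolute moment. Instead of Cauchy-Schwarz, the pointwise
  inequality \<open>2 * r * \<bar>x\<bar> \<le> x^2 + r^2\<close> is averaged with the optimal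
  \<open>r = sqrt n\<close>.\<close>

lemma binomial_mean_deviation:
  "binomial_mean n (\<lambda>k. \<bar>2 * real k - real n\<bar>) \<le> sqrt (real n)"
proof (cases "n = 0")
  case True
  then show ?thesis by (simp add: binomial_mean_def)
next
  case False
  define r where "r = sqrt (real n)"
  have r: "r > 0" "r\<^sup>2 = n"
    using False by (auto simp: r_def)
  have "\<bar>x\<bar> \<le> 1 / (2 * r) * x\<^sup>2 + r / 2" for x
  proof -
    have "0 \<le> (\<bar>x\<bar> - r)\<^sup>2" by simp
    then show ?thesis
      using r by (simp add: field_simps power2_eq_square)
  qed
  then have "binomial_mean n (\<lambda>k. \<bar>2 * real k - real n\<bar>)
      \<le> binomial_mean n (\<lambda>k. 1 / (2 * r) * (2 * real k - real n)\<^sup>2 + r / 2)"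
    by (intro binomial_mean_mono) auto
  also have "\<dots> = 1 / (2 * r) * real n + r / 2"
    by (simp only: binomial_mean_add binomial_mean_cmult binomial_mean_variance binomial_mean_const)
  also have "\<dots> = r"
    using r by (simp add: field_simps flip: r(2)) (simp add: power2_eq_square)
  finally show ?thesis by (simp add: r_def)
qed

text \<open>The absorption identities (1 and 2 below) move both sums to row \<open>n + 1\<close>,
  where their weights differ by the factor \<open>k - (n + 1 - k)\<close>. The leading 2 compensates
  for the denominator \<open>2 ^ (n + 1)\<close>.\<close>

lemma binomial_mean_shift_eq:
  "binomial_mean n (\<lambda>k. f (Suc k)) - binomial_mean n f =
     2 / real (Suc n) * binomial_mean (Suc n) (\<lambda>k. (2 * real k - real (Suc n)) * f k)"
proof -
  have 1: "real (Suc n) * (\<Sum>k\<le>n. real (n choose k) * f (Suc k)) =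
      (\<Sum>k\<le>Suc n. real (Suc n choose k) * (real k * f k))"
  proof -
    have "real (Suc n) * real (n choose k) = real (Suc n choose Suc k) * real (Suc k)" for k
      by (metis Suc_times_binomial_eq of_nat_mult)
    then show ?thesis
      by (subst sum.atMost_Suc_shift) (simp add: sum_distrib_left flip: mult.assoc)
  qed
  have 2: "real (Suc n) * (\<Sum>k\<le>n. real (n choose k) * f k) =
      (\<Sum>k\<le>Suc n. real (Suc n choose k) * ((real (Suc n) - real k) * f k))"
  proof -
    have "real (Suc n) * real (n choose k) = real (Suc n choose k) * (real (Suc n) - real k)"
      if "k \<le> n" for k
      using that binomial_absorb_comp[of "Suc n" k]
      by (metis diff_Suc_1 le_SucI mult.commute of_nat_diff of_nat_mult)
    then show ?thesis
      by (simp add: sum_distrib_left flip: mult.assoc)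
  qed
  have "real (Suc n) * ((\<Sum>k\<le>n. real (n choose k) * f (Suc k)) - (\<Sum>k\<le>n. real (n choose k) * f k))
      = (\<Sum>k\<le>Suc n. real (Suc n choose k) * ((2 * real k - real (Suc n)) * f k))"
    by (subst right_diff_distrib, unfold 1 2 sum_subtractf[symmetric], intro sum.cong)
       (auto simp: algebra_simps)
  then have eq: "(\<Sum>k\<le>Suc n. real (Suc n choose k) * ((2 * real k - real (Suc n)) * f k)) =
      real (Suc n) * ((\<Sum>k\<le>n. real (n choose k) * f (Suc k)) - (\<Sum>k\<le>n. real (n choose k) * f k))"
    by simp
  show ?thesis
    unfolding binomial_mean_def eq by (simp add: diff_divide_distrib)
qed

text \<open>By \<open>binomial_mean_shift_eq\<close> and the deviation bound in row
  \<open>n + 1\<close>, each unit shift costs at most \<open>2 / sqrt (n + 1)\<close>; these costs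
  add up over \<open>j\<close> shifts.\<close>

lemma binomial_mean_shift:
  assumes f: "\<And>k. \<bar>f k\<bar> \<le> 1"
  shows "\<bar>binomial_mean n (\<lambda>k. f (k + j)) - binomial_mean n f\<bar> \<le> 2 * real j / sqrt (real (Suc n))"
proof (induction j)
  case 0
  show ?case by simp
next
  case (Suc j)
  let ?g = "\<lambda>k. f (k + j)" and ?m = "real (Suc n)"
  have "\<bar>binomial_mean (Suc n) (\<lambda>k. (2 * real k - ?m) * ?g k)\<bar>
      \<le> binomial_mean (Suc n) (\<lambda>k. \<bar>2 * real k - ?m\<bar>)"
    by (intro order_trans[OF abs_binomial_mean_le] binomial_mean_mono)
       (simp add: abs_mult f mult_left_le)
  also have "\<dots> \<le> sqrt ?m"
    by (rule binomial_mean_deviation)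
  finally have "\<bar>binomial_mean n (\<lambda>k. ?g (Suc k)) - binomial_mean n ?g\<bar> \<le> 2 / ?m * sqrt ?m"
    unfolding binomial_mean_shift_eq[of n ?g] abs_mult by (intro mult_mono) auto
  also have "\<dots> = 2 / sqrt ?m"
    by (simp add: real_div_sqrt field_simps)
  finally have "\<bar>binomial_mean n (\<lambda>k. f (k + Suc j)) - binomial_mean n ?g\<bar> \<le> 2 / sqrt ?m"
    by simp
  with Suc.IH show ?case
    by (simp add: algebra_simps add_divide_distrib)
qed

text \<open>The mean of \<open>f\<close> is compared with the mean of its average over
  \<open>q\<close> consecutive shifts: the shifts account for the first error term, the deviation of
  the block average from \<open>t\<close> for the second.\<close>

lemma binomial_mean_near_average:
  assumes f: "\<And>k. \<bar>f k\<bar> \<le> 1" and q: "q > 0"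
    and avg: "\<And>k. \<bar>(\<Sum>j<q. f (k + j)) - real q * t\<bar> \<le> C"
  shows "\<bar>binomial_mean n f - t\<bar> \<le> 2 * real q / sqrt (real (Suc n)) + C / real q"
proof -
  let ?e = "2 * real q / sqrt (real (Suc n))"
  have "\<bar>binomial_mean n (\<lambda>k. (\<Sum>j<q. f (k + j)) - real q * t)\<bar> \<le> C"
    using order_trans[OF abs_binomial_mean_le binomial_mean_mono[OF avg]] by simp
  then have A: "\<bar>(\<Sum>j<q. binomial_mean n (\<lambda>k. f (k + j))) - real q * t\<bar> \<le> C"
    by (simp only: binomial_mean_diff binomial_mean_sum binomial_mean_const)
  have "\<bar>\<Sum>j<q. binomial_mean n (\<lambda>k. f (k + j)) - binomial_mean n f\<bar> \<le> (\<Sum>j<q. ?e)"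
  proof (intro order_trans[OF sum_abs] sum_mono)
    fix j assume "j \<in> {..<q}"
    then show "\<bar>binomial_mean n (\<lambda>k. f (k + j)) - binomial_mean n f\<bar> \<le> ?e"
      by (intro order_trans[OF binomial_mean_shift] f divide_right_mono) auto
  qed
  then have "\<bar>(\<Sum>j<q. binomial_mean n (\<lambda>k. f (k + j))) - real q * binomial_mean n f\<bar> \<le> real q * ?e"
    by (simp add: sum_subtractf)
  with A have "\<bar>real q * (binomial_mean n f - t)\<bar> \<le> real q * ?e + C"
    by (simp add: algebra_simps)
  then have "real q * \<bar>binomial_mean n f - t\<bar> \<le> real q * (?e + C / real q)"
    using q by (simp add: abs_mult distrib_left)
  then show ?thesis
    using q by simp
qed

section \<open>Equidistribution of blocks of consecutive points modulo 1\<close>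

text \<open>Up to a bounded error on the scale \<open>1 / q\<close>, the points form the full grid
  of multiples of \<open>1 / q\<close> modulo 1, since multiplication by \<open>a\<close> permutes
  the residues modulo \<open>q\<close>. Counting grid points in an interval then loses only a
  constant.\<close>

lemma card_frac_le:
  fixes x y t :: real and a :: int and q :: nat
  assumes q: "q > 0" and cop: "coprime a (int q)"
    and approx: "\<bar>y - of_int a / real q\<bar> \<le> 1 / (real q)\<^sup>2"
    and t: "0 \<le> t" "t \<le> 1"
  shows "\<bar>real (card {j \<in> {..<q}. frac (x + real j * y) \<le> t}) - real q * t\<bar> \<le> 3"
proof -
  \<comment> \<open>These give \<open>q * (x + j * y) = m + j * a + e j\<close>, with
    \<open>i j\<close> the residue of the integer part. In \<open>e j\<close> the fractional part
    lies in \<open>[0, 1)\<close> and the drift is at most \<open>j / q < 1\<close> in absolute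
    value.\<close>
  define m where "m = \<lfloor>x * real q\<rfloor>"
  define i where "i j = (m + int j * a) mod int q" for j :: nat
  define e where "e j = frac (x * real q) + real j * (real q * (y - of_int a / real q))" for j :: nat
  have i_range: "0 \<le> i j" "i j < int q" for j
    using q by (auto simp: i_def)
  have inj: "inj_on i {..<q}"
  proof (rule inj_onI)
    fix j k assume jk: "j \<in> {..<q}" "k \<in> {..<q}" "i j = i k"
    then have "int q dvd (int j - int k) * a"
      by (simp add: i_def mod_eq_dvd_iff algebra_simps)
    then have "int q dvd int j - int k"
      using cop by (simp add: coprime_dvd_mult_left_iff coprime_commute)
    then show "j = k"
      using jk zdvd_imp_le[of "int q" "int j - int k"] zdvd_imp_le[of "int q" "int k - int j"]
      by (cases "int j - int k" "0::int" rule: linorder_cases) (auto simp: dvd_diff_commute)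
  qed
  have e: "-1 < e j" "e j < 2" if "j < q" for j
  proof -
    have "\<bar>real j * (real q * (y - of_int a / real q))\<bar> = real j * real q * \<bar>y - of_int a / real q\<bar>"
      by (simp add: abs_mult)
    also have "\<dots> \<le> real j * real q * (1 / (real q)\<^sup>2)"
      by (intro mult_left_mono approx) auto
    also have "\<dots> < 1"
      using q that by (simp add: power2_eq_square)
    finally show "-1 < e j" "e j < 2"
      unfolding e_def using frac_ge_0[of "x * real q"] frac_lt_1[of "x * real q"] by linarith+
  qed
  \<comment> \<open>Away from the two ends of the grid, the error \<open>e j\<close> causes no wrap-around modulo 1.\<close>
  have frac_eq: "frac (x + real j * y) = (of_int (i j) + e j) / real q"
    if j: "j < q" and "i j \<noteq> 0" "i j \<noteq> int q - 1" for j
  proof -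
    have "1 \<le> i j" "i j \<le> int q - 2"
      using that i_range[of j] by linarith+
    then have ij: "1 \<le> real_of_int (i j)" "real_of_int (i j) \<le> real q - 2"
      by linarith+
    have "x + real j * y - (of_int (i j) + e j) / real q = (of_int (m + int j * a) - of_int (i j)) / real q"
      using q by (simp add: e_def m_def frac_def field_simps)
    also have "\<dots> = of_int ((m + int j * a) div int q)"
    proof -
      have "m + int j * a - i j = (m + int j * a) div int q * int q"
        unfolding i_def by (simp add: minus_mod_eq_div_mult)
      then have "real_of_int (m + int j * a) - of_int (i j) = of_int ((m + int j * a) div int q) * real q"
        by (metis of_int_diff of_int_mult of_int_of_nat_eq)
      then show ?thesis
        using q by simp
    qed
    finally show ?thesis
      using q ij e[OF j] by (auto simp: frac_unique_iff)
  qed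
  let ?A = "{j \<in> {..<q}. frac (x + real j * y) \<le> t}"
    and ?B = "{j \<in> {..<q}. \<not> frac (x + real j * y) \<le> t}"
  have "i ` ?A \<subseteq> insert (int q - 1) {0..\<lceil>real q * t\<rceil>}"
  proof
    fix z assume "z \<in> i ` ?A"
    then obtain j where j: "j < q" "frac (x + real j * y) \<le> t" and z: "z = i j" by auto
    show "z \<in> insert (int q - 1) {0..\<lceil>real q * t\<rceil>}"
    proof (cases "i j = 0 \<or> i j = int q - 1")
      case True
      moreover have "0 \<le> real q * t" using t by simp
      ultimately show ?thesis using z by auto
    next
      case False
      then have "of_int (i j) + e j = real q * frac (x + real j * y)"
        using frac_eq[of j] j q by simp
      then have "of_int (i j) + e j \<le> real q * t"
        using j by (simp add: mult_left_mono)
      then have "i j \<le> \<lceil>real q * t\<rceil>"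
        using e[of j] j by linarith
      then show ?thesis using z i_range by auto
    qed
  qed
  then have "card ?A \<le> card (insert (int q - 1) {0..\<lceil>real q * t\<rceil>})"
    by (intro card_inj_on_le[OF inj_on_subset[OF inj]]) auto
  also have "\<dots> \<le> Suc (nat (\<lceil>real q * t\<rceil> + 1))"
    by (rule order_trans[OF card_insert_le_m1]) auto
  finally have A: "real (card ?A) \<le> real q * t + 3"
    using t mult_nonneg_nonneg[of "real q" t] by linarith
  \<comment> \<open>The lower bound on \<open>card ?A\<close> comes from an upper bound on its
    complement in \<open>{..<q}\<close>. Here \<open>e j < 2\<close> gives
    \<open>i j > q * t - 2\<close> away from the ends of the grid.\<close>
  have "i ` ?B \<subseteq> insert 0 {\<lfloor>real q * t\<rfloor> - 1..int q - 1}"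
  proof
    fix z assume "z \<in> i ` ?B"
    then obtain j where j: "j < q" "\<not> frac (x + real j * y) \<le> t" and z: "z = i j" by auto
    have tq: "real q * t \<le> real q" using t by (simp add: mult_left_le)
    show "z \<in> insert 0 {\<lfloor>real q * t\<rfloor> - 1..int q - 1}"
    proof (cases "i j = 0 \<or> i j = int q - 1")
      case True
      moreover have "\<lfloor>real q * t\<rfloor> \<le> int q" using tq by linarith
      ultimately show ?thesis using z by auto
    next
      case False
      then have "of_int (i j) + e j = real q * frac (x + real j * y)"
        using frac_eq[of j] j q by simp
      then have "of_int (i j) + e j > real q * t"
        using j q by simp
      then have "\<lfloor>real q * t\<rfloor> - 1 \<le> i j"
        using e[of j] j by linarith
      then show ?thesis using z i_range[of j] by auto
    qed
  qed
  then have "card ?B \<le> card (insert 0 {\<lfloor>real q * t\<rfloor> - 1..int q - 1})"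
    by (intro card_inj_on_le[OF inj_on_subset[OF inj]]) auto
  also have "\<dots> \<le> Suc (nat (int q - \<lfloor>real q * t\<rfloor> + 1))"
    by (rule order_trans[OF card_insert_le_m1]) auto
  finally have B: "real (card ?B) \<le> real q - real q * t + 3"
    using t mult_left_le[of t "real q"] by linarith
  have "card ?A + card ?B = card (?A \<union> ?B)"
    by (intro card_Un_disjoint[symmetric]) auto
  also have "?A \<union> ?B = {..<q}" by auto
  finally have "real (card ?A) + real (card ?B) = real q"
    unfolding of_nat_add[symmetric] card_lessThan by (rule arg_cong)
  with A B show ?thesis
    by linarith
qed

lemma binomial_mean_frac_le:
  fixes c y t :: real and a :: int and q :: nat
  assumes "q > 0" "coprime a (int q)" "\<bar>y - of_int a / real q\<bar> \<le> 1 / (real q)\<^sup>2" "0 \<le> t" "t \<le> 1"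
  shows "\<bar>binomial_mean n (\<lambda>k. of_bool (frac (c + real k * y) \<le> t)) - t\<bar>
      \<le> 2 * real q / sqrt (real (Suc n)) + 3 / real q"
proof (rule binomial_mean_near_average)
  fix k
  have "(\<Sum>j<q. of_bool (frac (c + real (k + j) * y) \<le> t)) =
      real (card {j \<in> {..<q}. frac ((c + real k * y) + real j * y) \<le> t})"
    by (simp add: algebra_simps Int_def)
  then show "\<bar>(\<Sum>j<q. of_bool (frac (c + real (k + j) * y) \<le> t)) - real q * t\<bar> \<le> 3"
    using card_frac_le[OF assms] by simp
qed (use assms in auto)

section \<open>Convergence for irrational \<open>y\<close> and its failure for rational
  \<open>y\<close>\<close>

text \<open>The bound of \<open>binomial_mean_frac_le\<close> is uniform in the offset, so
  \<open>c\<close> may vary with \<open>n\<close>. First \<open>q\<close> is fixed to make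
  \<open>3 / q\<close> small, then \<open>n\<close> grows.\<close>

lemma irrational_imp_binomial_mean_tendsto:
  fixes c :: "nat \<Rightarrow> real" and y t :: real
  assumes y: "y \<notin> \<rat>" and t: "0 \<le> t" "t \<le> 1"
  shows "(\<lambda>n. binomial_mean n (\<lambda>k. of_bool (frac (c n + real k * y) \<le> t))) \<longlonglongrightarrow> t"
proof (rule metric_LIMSEQ_I)
  fix r :: real assume r: "r > 0"
  have "infinite (approx_set y)"
    using y rational_iff_finite_approx_set by blast
  then obtain a k where ak: "(a, k) \<in> approx_set y" "k > \<lceil>6 / r\<rceil>"
    using infinite_approx_set by blast
  define q where "q = nat k"
  have q: "q > 0" "coprime a (int q)" "\<bar>y - of_int a / real q\<bar> \<le> 1 / (real q)\<^sup>2"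
    using ak by (auto simp: approx_set_def q_def)
  have "6 / r < real q"
    using ak q(1) by (simp add: q_def) linarith
  then have q_large: "3 / real q < r / 2"
    using r q(1) by (simp add: field_simps)
  have "(\<lambda>n. 2 * real q / sqrt (real (Suc n))) \<longlonglongrightarrow> 0"
    by real_asymp
  then have "\<forall>\<^sub>F n in sequentially. 2 * real q / sqrt (real (Suc n)) < r / 2"
    using r by (intro order_tendstoD) auto
  then have "\<forall>\<^sub>F n in sequentially.
      dist (binomial_mean n (\<lambda>k. of_bool (frac (c n + real k * y) \<le> t))) t < r"
  proof (eventually_elim)
    case (elim n)
    then show ?case
      using binomial_mean_frac_le[OF q t, of n "c n"] q_large by (simp add: dist_real_def)
  qed
  then show "\<exists>no. \<forall>n\<ge>no. dist (binomial_mean n (\<lambda>k. of_bool (frac (c n + real k * y) \<le> t))) t < r"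
    by (simp add: eventually_sequentially)
qed

lemma rational_imp_not_binomial_mean_tendsto:
  fixes c :: "nat \<Rightarrow> real" and y :: real
  assumes y: "y \<in> \<rat>"
  shows "\<exists>t\<in>{0..<1}. \<not> (\<lambda>n. binomial_mean n (\<lambda>k. of_bool (frac (c n + real k * y) \<le> t))) \<longlonglongrightarrow> t"
proof (rule ccontr)
  let ?P = "\<lambda>t n. binomial_mean n (\<lambda>k. of_bool (frac (c n + real k * y) \<le> t))"
  assume "\<not> ?thesis"
  then have lim: "?P t \<longlonglongrightarrow> t" if "0 \<le> t" "t < 1" for t
    using that by auto
  obtain a b where y_eq: "y = of_int a / of_int b" and "b > 0"
    using y by (meson Rats_cases')
  define q where "q = nat b"
  have q: "q > 0" "y = of_int a / real q"
    using \<open>b > 0\<close> y_eq by (auto simp: q_def)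
  \<comment> \<open>The denominator \<open>q + 2\<close> leaves room for \<open>q + 1\<close>
    disjoint intervals from \<open>u i\<close> to \<open>u (Suc i)\<close> with all endpoints below
    1, where the assumed limits are available.\<close>
  define u where "u i = real i / real (q + 2)" for i :: nat
  have u: "0 \<le> u i" "u i < 1" "u i < u (Suc i)" if "i < q + 2" for i
    using that by (auto simp: u_def divide_strict_right_mono)
  have "\<forall>\<^sub>F n in sequentially. ?P (u i) n < ?P (u (Suc i)) n" if "i \<le> q" for i
  proof -
    have "(\<lambda>n. ?P (u (Suc i)) n - ?P (u i) n) \<longlonglongrightarrow> u (Suc i) - u i"
      using that by (intro tendsto_diff lim u) auto
    then have "\<forall>\<^sub>F n in sequentially. 0 < ?P (u (Suc i)) n - ?P (u i) n"
      using u(3)[of i] that by (intro order_tendstoD) auto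
    then show ?thesis by simp
  qed
  then have "\<forall>\<^sub>F n in sequentially. \<forall>i\<in>{..q}. ?P (u i) n < ?P (u (Suc i)) n"
    by (simp add: eventually_ball_finite)
  \<comment> \<open>As there are finitely many intervals, a single stage \<open>n\<close> gives all
    of them positive mass; the offset \<open>c n\<close> is fixed from here on.\<close>
  then obtain n where n: "?P (u i) n < ?P (u (Suc i)) n" if "i \<le> q" for i
    by (auto dest!: eventually_happens)
  define g where "g k = frac (c n + real k * y)" for k :: nat
  have "\<exists>k. u i < g k \<and> g k \<le> u (Suc i)" if "i \<le> q" for i
  proof (rule ccontr)
    assume no: "\<not> ?thesis"
    have "?P (u (Suc i)) n \<le> ?P (u i) n"
      using no by (intro binomial_mean_mono) (auto simp: g_def not_le[symmetric] of_bool_def)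
    with n[OF that] show False by simp
  qed
  then obtain K where K: "u i < g (K i)" "g (K i) \<le> u (Suc i)" if "i \<le> q" for i
    by metis
  have "u i \<le> u j" if "i \<le> j" for i j
    using that by (simp add: u_def divide_right_mono)
  then have less: "g (K i) < g (K j)" if "i < j" "j \<le> q" for i j
    using K[of i] K[of j] that by (meson Suc_leI le_less_trans less_imp_le order_trans)
  have inj: "inj_on (\<lambda>i. g (K i)) {..q}"
    by (rule linorder_inj_onI') (use less in fastforce)
  \<comment> \<open>Since \<open>q * y = a\<close> is an integer, \<open>g\<close> has period
    \<open>q\<close>, hence at most \<open>q\<close> values, whereas \<open>g (K i)\<close> takes
    \<open>q + 1\<close> distinct ones.\<close>
  have "g k = g (k mod q)" for k
  proof -
    have "real k = real (k div q) * real q + real (k mod q)"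
      by (metis div_mult_mod_eq of_nat_add of_nat_mult)
    then have "c n + real k * y = (c n + real (k mod q) * y) + of_int (int (k div q) * a)"
      using q by (simp add: field_simps)
    then show ?thesis
      unfolding g_def by (metis frac_add_of_int_right)
  qed
  then have "(\<lambda>i. g (K i)) ` {..q} \<subseteq> g ` {..<q}"
    using q(1) by (metis imageI image_subsetI lessThan_iff mod_less_divisor)
  then have "card {..q} \<le> card (g ` {..<q})"
    by (intro card_inj_on_le[OF inj]) auto
  also have "\<dots> \<le> card {..<q}"
    by (rule card_image_le) auto
  finally show False by simp
qed

section \<open>Significands, the cutting process and stick lengths\<close>

text \<open>On the logarithmic scale the decomposition is the splitting of \<open>log 10 x\<close>
  into integer and fractional part, whose uniqueness evaluates the definite description.\<close>

lemma significand10_eq: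
  assumes "x > 0"
  shows "significand10 x = 10 powr frac (log 10 x)"
  unfolding significand10_def
proof (rule the_equality)
  have "x = 10 powr (frac (log 10 x) + of_int \<lfloor>log 10 x\<rfloor>)"
    using assms by (simp add: frac_def)
  then have "x = 10 powr frac (log 10 x) * 10 powi \<lfloor>log 10 x\<rfloor>"
    by (simp add: powr_add powr_real_of_int')
  moreover have "10 powr frac (log 10 x) < 10 powr 1"
    by (intro powr_less_mono frac_lt_1) auto
  ultimately show "1 \<le> 10 powr frac (log 10 x) \<and> 10 powr frac (log 10 x) < 10 \<and>
      (\<exists>k::int. x = 10 powr frac (log 10 x) * 10 powi k)"
    by (auto simp: ge_one_powr_ge_zero)
next
  fix s assume s: "1 \<le> s \<and> s < 10 \<and> (\<exists>k::int. x = s * 10 powi k)"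
  then obtain k :: int where k: "x = s * 10 powi k" by blast
  have "log 10 x = log 10 s + of_int k"
    using s by (simp add: k log_mult flip: powr_real_of_int')
  moreover have "0 \<le> log 10 s" "log 10 s < 1"
    using s by auto
  ultimately have "frac (log 10 x) = log 10 s"
    by (simp add: frac_unique_iff)
  then show "s = 10 powr frac (log 10 x)"
    using s by simp
qed

lemma signif_le_eq:
  assumes "x > 0" "s > 0"
  shows "signif_le s x = of_bool (frac (log 10 x) \<le> log 10 s)"
  using assms by (simp add: signif_le_def significand10_eq le_log_iff)

lemma log_stick_length:
  assumes "0 < p" "p < 1" "0 < L" and y: "10 powr y = (1 - p) / p" and "k \<le> N"
  shows "log 10 (stick_length p L N (Suc k)) = (log 10 L + real N * log 10 p) + real k * y"
proof -
  have "y = log 10 ((1 - p) / p)"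
    by (simp flip: y)
  then have "log 10 (1 - p) = log 10 p + y"
    using assms by (simp add: log_divide)
  then show ?thesis
    using assms by (simp add: stick_length_def log_mult log_nat_power algebra_simps of_nat_diff)
qed

lemma sum_1_shift: "(\<Sum>n = 1..N + 1. f n) = (\<Sum>k\<le>N. f (Suc k))"
  using sum.shift_bounds_cl_Suc_ivl[of f 0 N] by (simp add: atMost_atLeast0)

lemma stick_cdf_eq:
  assumes "0 < p" "p < 1" "0 < L" "10 powr y = (1 - p) / p" "s > 0"
  shows "stick_cdf p L N s =
    binomial_mean N (\<lambda>k. of_bool (frac ((log 10 L + real N * log 10 p) + real k * y) \<le> log 10 s))"
proof -
  have "signif_le s (stick_length p L N (Suc k)) =
      of_bool (frac ((log 10 L + real N * log 10 p) + real k * y) \<le> log 10 s)" if "k \<le> N" for k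
  proof -
    have "stick_length p L N (Suc k) > 0"
      using assms by (simp add: stick_length_def)
    then show ?thesis
      using signif_le_eq[OF _ \<open>s > 0\<close>] log_stick_length[OF assms(1-4) that] by simp
  qed
  then show ?thesis
    unfolding stick_cdf_def sum_1_shift binomial_mean_def by simp
qed

lemma sum_mset_pair_image:
  "(\<Sum>x\<in>#M. {#f x, g x#}) = image_mset f M + image_mset g M"
  by (induction M) auto

lemma image_mset_sum: "image_mset f (\<Sum>k\<in>A. F k) = (\<Sum>k\<in>A. image_mset f (F k))"
  by (induction A rule: infinite_finite_induct) auto

text \<open>A cut keeps the index of the piece scaled by \<open>p\<close> and raises that of the
  piece scaled by \<open>1 - p\<close> by one; Pascal's rule merges the two families.\<close>

lemma sticks_eq:
  "sticks p L N = (\<Sum>k\<le>N. replicate_mset (N choose k) (stick_length p L N (Suc k)))"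
proof (induction N)
  case 0
  show ?case by (simp add: stick_length_def)
next
  case (Suc N)
  have 1: "stick_length p L N (Suc k) * p = stick_length p L (Suc N) (Suc k)"
    and 2: "stick_length p L N (Suc k) * (1 - p) = stick_length p L (Suc N) (Suc (Suc k))"
    if "k \<le> N" for k
    using that by (simp_all add: stick_length_def Suc_diff_le)
  have "sticks p L (Suc N) =
      (\<Sum>k\<le>N. replicate_mset (N choose k) (stick_length p L (Suc N) (Suc k))) +
      (\<Sum>k\<le>N. replicate_mset (N choose k) (stick_length p L (Suc N) (Suc (Suc k))))"
    by (simp only: sticks.simps sum_mset_pair_image, simp add: Suc.IH image_mset_sum 1 2)
  also have "\<dots> = (\<Sum>k\<le>Suc N. replicate_mset (Suc N choose k) (stick_length p L (Suc N) (Suc k)))"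
    by (rule sum_binomial_Suc[symmetric]) (auto intro: multiset_eqI)
  finally show ?case .
qed

lemma size_sticks: "size (sticks p L N) = 2 ^ N"
  by (induction N) (simp_all add: sum_mset_pair_image)

text \<open>For indices at distance \<open>d > 0\<close>, removing the common positive factor leaves
  \<open>p ^ d\<close> against \<open>(1 - p) ^ d\<close>.\<close>

lemma inj_on_stick_length:
  assumes p: "0 < p" "p < 1" "p \<noteq> 1 / 2" and "0 < L"
  shows "inj_on (stick_length p L N) {1..N + 1}"
proof (rule linorder_inj_onI')
  fix m n assume mn: "m \<in> {1..N + 1}" "n \<in> {1..N + 1}" "m < n"
  define d where "d = n - m"
  have "N + 1 - m = (N + 1 - n) + d" "n - 1 = (m - 1) + d" "d > 0"
    using mn by (auto simp: d_def)
  then have "stick_length p L N m = (L * p ^ (N + 1 - n) * (1 - p) ^ (m - 1)) * p ^ d"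
    and "stick_length p L N n = (L * p ^ (N + 1 - n) * (1 - p) ^ (m - 1)) * (1 - p) ^ d"
    by (simp_all only: stick_length_def power_add mult_ac)
  moreover have "p ^ d \<noteq> (1 - p) ^ d"
    using p \<open>d > 0\<close> by (subst power_eq_iff_eq_base) auto
  ultimately show "stick_length p L N m \<noteq> stick_length p L N n"
    using p \<open>0 < L\<close> by simp
qed

section \<open>Irrationality exponent and rate of convergence\<close>

text \<open>Above the supremum the liminf is nonzero, hence positive, which bounds all large
  \<open>q\<close>. Each of the finitely many remaining \<open>q\<close> has a positive bound
  because \<open>y\<close> is irrational.\<close>

lemma irrationality_exponent_lower_bound:
  fixes y \<gamma> :: real
  assumes y: "y \<notin> \<rat>" and \<gamma>: "irrationality_exponent y < ereal \<gamma>"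
  obtains C where "C > 0"
    "\<And>q a. q > 0 \<Longrightarrow> C \<le> real q powr (\<gamma> + 1) * \<bar>y - of_int a / real q\<bar>"
proof -
  let ?I = "\<lambda>q. INF a::int. \<bar>y - of_int a / real q\<bar>"
  let ?X = "\<lambda>q. ereal (real q powr (\<gamma> + 1) * ?I q)"
  have "liminf ?X \<noteq> 0"
  proof
    assume "liminf ?X = 0"
    then have "ereal \<gamma> \<le> irrationality_exponent y"
      unfolding irrationality_exponent_def by (intro Sup_upper) auto
    with \<gamma> show False by simp
  qed
  moreover have "0 \<le> liminf ?X"
    by (intro Liminf_bounded always_eventually allI) (auto intro!: mult_nonneg_nonneg cINF_greatest)
  ultimately have "0 < liminf ?X"
    by simp
  then obtain C0 where C0: "0 < ereal C0" "ereal C0 < liminf ?X"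
    using ereal_dense2 by blast
  then have "\<forall>\<^sub>F q in sequentially. C0 < real q powr (\<gamma> + 1) * ?I q"
    using less_LiminfD by fastforce
  then obtain Q where Q: "\<And>q. q \<ge> Q \<Longrightarrow> C0 < real q powr (\<gamma> + 1) * ?I q"
    by (auto simp: eventually_sequentially)
  have "\<exists>C>0. \<forall>q\<in>{0<..<n}. \<forall>a::int. C \<le> real q powr (\<gamma> + 1) * \<bar>y - of_int a / real q\<bar>" for n
  proof (induction n)
    case 0
    show ?case by (auto intro: exI[of _ 1])
  next
    case (Suc n)
    then obtain C where C: "C > 0"
        "\<And>q a. q \<in> {0<..<n} \<Longrightarrow> C \<le> real q powr (\<gamma> + 1) * \<bar>y - of_int a / real q\<bar>" by blast
    \<comment> \<open>\<open>d\<close> is the distance from \<open>n * y\<close> to the nearest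
      integer. For \<open>n = 0\<close> no new denominator enters, so \<open>D = 1\<close> is a
      dummy value.\<close>
    define d where "d = min (frac (real n * y)) (1 - frac (real n * y))"
    define D where "D = (if n = 0 then 1 else real n powr (\<gamma> + 1) * (d / real n))"
    have "D > 0"
    proof (cases "n = 0")
      case False
      have "real n * y \<notin> \<int>"
      proof
        assume "real n * y \<in> \<int>"
        then have "real n * y / real n \<in> \<rat>"
          by (metis Ints_subset_Rats Rats_divide Rats_of_nat subsetD)
        with False y show False by simp
      qed
      then have "d > 0"
        by (simp add: d_def frac_lt_1)
      with False show ?thesis by (simp add: D_def)
    qed (simp add: D_def)
    moreover have "D \<le> real n powr (\<gamma> + 1) * \<bar>y - of_int a / real n\<bar>" if "n > 0" for a :: int
    proof -
      have "d \<le> \<bar>real n * y - of_int a\<bar>"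
      proof (cases "a \<le> \<lfloor>real n * y\<rfloor>")
        case True
        then have "frac (real n * y) \<le> \<bar>real n * y - of_int a\<bar>"
          unfolding frac_def by linarith
        then show ?thesis by (simp add: d_def)
      next
        case False
        then have "1 - frac (real n * y) \<le> \<bar>real n * y - of_int a\<bar>"
          unfolding frac_def by linarith
        then show ?thesis by (simp add: d_def)
      qed
      also have "\<dots> = real n * \<bar>y - of_int a / real n\<bar>"
        using that by (simp add: abs_mult_pos' right_diff_distrib)
      finally have "d / real n \<le> \<bar>y - of_int a / real n\<bar>"
        using that by (simp add: field_simps)
      then show ?thesis
        using that unfolding D_def by (simp add: mult_left_mono del: times_divide_eq_right)
    qed
    ultimately show ?case
      using C by (intro exI[of _ "min C D"]) (auto simp: less_Suc_eq min_le_iff_disj)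
  qed
  then obtain C1 where C1: "C1 > 0"
      "\<And>q a. q \<in> {0<..<Q} \<Longrightarrow> C1 \<le> real q powr (\<gamma> + 1) * \<bar>y - of_int a / real q\<bar>" by blast
  show thesis
  proof (rule that[of "min C0 C1"])
    show "min C0 C1 > 0" using C0 C1 by simp
    fix q :: nat and a :: int assume "q > 0"
    show "min C0 C1 \<le> real q powr (\<gamma> + 1) * \<bar>y - of_int a / real q\<bar>"
    proof (cases "q < Q")
      case True
      with C1 \<open>q > 0\<close> show ?thesis by (auto simp: min_le_iff_disj)
    next
      case False
      have "?I q \<le> \<bar>y - of_int a / real q\<bar>"
        by (intro cINF_lower bdd_belowI[of _ 0]) auto
      then have "real q powr (\<gamma> + 1) * ?I q \<le> real q powr (\<gamma> + 1) * \<bar>y - of_int a / real q\<bar>"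
        by (intro mult_left_mono) auto
      with Q[of q] False show ?thesis by simp
    qed
  qed
qed

lemma binomial_mean_frac_rate:
  fixes y t \<gamma> :: real and c :: "nat \<Rightarrow> real"
  assumes y: "y \<notin> \<rat>" and \<gamma>: "\<gamma> \<ge> 1" "irrationality_exponent y < ereal \<gamma>" and t: "0 \<le> t" "t \<le> 1"
  shows "(\<lambda>n. binomial_mean n (\<lambda>k. of_bool (frac (c n + real k * y) \<le> t)) - t)
      \<in> O(\<lambda>n. real n powr (- (1 / (4 * \<gamma>))))"
proof -
  obtain C where C: "C > 0" "\<And>q a. q > 0 \<Longrightarrow> C \<le> real q powr (\<gamma> + 1) * \<bar>y - of_int a / real q\<bar>"
    using irrationality_exponent_lower_bound[OF y \<gamma>(2)] by blast
  \<comment> \<open>The 4 comes from \<open>2 * q \<le> 4 * R\<close>, the other summand from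
    \<open>3 / q\<close> and the lower bound \<open>q_ge\<close> below.\<close>
  define K where "K = 4 + 3 * C powr (- (1 / \<gamma>))"
  have "\<bar>binomial_mean n (\<lambda>k. of_bool (frac (c n + real k * y) \<le> t)) - t\<bar>
      \<le> K * real n powr (- (1 / (4 * \<gamma>)))" if n: "n > 0" for n
  proof -
    \<comment> \<open>With \<open>q\<close> at most of order \<open>R\<close>, the shift error is of
      order \<open>R / sqrt n = n powr (- (1 / 4))\<close>.\<close>
    define R where "R = real n powr (1 / 4)"
    define Q where "Q = nat \<lceil>R\<rceil>"
    have R: "R \<ge> 1" using n by (simp add: R_def ge_one_powr_ge_zero)
    have Q: "Q > 0" "R \<le> real Q" "real Q \<le> 2 * R"
      using R by (auto simp: Q_def) linarith+
    obtain a k where k: "coprime a k" "0 < k" "k \<le> int Q" "\<bar>of_int k * y - of_int a\<bar> < 1 / real Q"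
      using Dirichlet_approx_coprime[OF Q(1)] by metis
    define q where "q = nat k"
    have q: "q > 0" "coprime a (int q)" "real q \<le> real Q" "\<bar>real q * y - of_int a\<bar> < 1 / real Q"
      using k by (auto simp: q_def)
    have eq: "\<bar>y - of_int a / real q\<bar> = \<bar>real q * y - of_int a\<bar> / real q"
    proof -
      have "y - of_int a / real q = (real q * y - of_int a) / real q"
        using q(1) by (simp add: field_simps)
      then show ?thesis by simp
    qed
    have "1 / real Q \<le> 1 / real q"
      using q by (simp add: field_simps)
    then have "\<bar>real q * y - of_int a\<bar> \<le> 1 / real q"
      using q(4) by linarith
    then have "\<bar>y - of_int a / real q\<bar> \<le> 1 / (real q)\<^sup>2"
      unfolding eq power2_eq_square by (simp add: divide_right_mono flip: divide_divide_eq_left)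
    note bound = binomial_mean_frac_le[OF q(1,2) this t, of n "c n"]
    \<comment> \<open>Dirichlet's error is below \<open>1 / Q \<le> 1 / R\<close>. Against the lower
      bound from the irrationality exponent, this prevents \<open>q\<close> from being
      small.\<close>
    have "C \<le> real q powr (\<gamma> + 1) * (\<bar>real q * y - of_int a\<bar> / real q)"
      using C(2)[OF q(1), of a] by (simp add: eq)
    also have "\<dots> = real q powr \<gamma> * \<bar>real q * y - of_int a\<bar>"
      using q(1) by (simp add: powr_add)
    also have "\<dots> \<le> real q powr \<gamma> * (1 / R)"
      using q(4) R Q by (intro mult_left_mono) (auto intro: order_trans[OF less_imp_le frac_le])
    finally have "C * R \<le> real q powr \<gamma>"
      using R by (simp add: field_simps)
    then have "(C * R) powr (1 / \<gamma>) \<le> (real q powr \<gamma>) powr (1 / \<gamma>)"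
      using C R \<gamma> by (intro powr_mono2) auto
    then have q_ge: "(C * R) powr (1 / \<gamma>) \<le> real q"
      using \<gamma> q(1) by (simp add: powr_powr)
    have "(C * R) powr (1 / \<gamma>) > 0"
      using C R by simp
    then have "3 / real q \<le> 3 / (C * R) powr (1 / \<gamma>)"
      using q_ge q(1) by (intro divide_left_mono) (auto intro!: mult_pos_pos)
    also have "\<dots> = 3 * C powr (- (1 / \<gamma>)) * R powr (- (1 / \<gamma>))"
      using C R by (simp add: powr_mult powr_minus field_simps)
    also have "R powr (- (1 / \<gamma>)) = real n powr (- (1 / (4 * \<gamma>)))"
      by (simp add: R_def powr_powr)
    finally have 1: "3 / real q \<le> 3 * C powr (- (1 / \<gamma>)) * real n powr (- (1 / (4 * \<gamma>)))" .
    have "2 * real q / sqrt (real (Suc n)) \<le> 4 * R / sqrt (real n)"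
      using q(3) Q n by (intro frac_le) auto
    also have "\<dots> = 4 * real n powr (- (1 / 4))"
    proof -
      have "sqrt (real n) = R * R"
        using n by (simp add: R_def powr_half_sqrt flip: powr_add)
      moreover have "real n powr (- (1 / 4)) = 1 / R"
        by (simp add: R_def powr_minus_divide)
      ultimately show ?thesis using R by simp
    qed
    also have "\<dots> \<le> 4 * real n powr (- (1 / (4 * \<gamma>)))"
      using n \<gamma> by (intro mult_left_mono powr_mono) (auto simp: field_simps)
    finally have 2: "2 * real q / sqrt (real (Suc n)) \<le> 4 * real n powr (- (1 / (4 * \<gamma>)))" .
    show ?thesis
      using bound 1 2 unfolding K_def distrib_right by linarith
  qed
  then show ?thesis
    by (intro bigoI[of _ K]) (auto simp: eventually_sequentially intro!: exI[of _ 1])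
qed

section \<open>Transfer of the binomial results to the sticks\<close>

theorem theorem1p11:
  "(\<forall>p L :: real. 0 < p \<and> p < 1 \<and> 0 < L \<longrightarrow>
      (\<forall>N. size (sticks p L N) = 2 ^ N \<and>
           sticks p L N =
             (\<Sum>n = 1..N + 1. replicate_mset (N choose (n - 1)) (stick_length p L N n)) \<and>
           (p \<noteq> 1 / 2 \<longrightarrow> card (stick_length p L N ` {1..N + 1}) = N + 1)))
   \<and>
   (\<forall>p L y :: real. 0 < p \<and> p < 1 \<and> 0 < L \<and> 10 powr y = (1 - p) / p \<longrightarrow>
      ((\<forall>s\<in>{1..<10}. (\<lambda>N. stick_cdf p L N s) \<longlonglongrightarrow> log 10 s) \<longleftrightarrow> y \<notin> \<rat>))
   \<and>
   (\<forall>\<kappa> :: real. \<exists>\<eta> :: real. \<eta> > 0 \<and>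
      (\<forall>p L y :: real. 0 < p \<and> p < 1 \<and> 0 < L \<and> 10 powr y = (1 - p) / p \<and>
         y \<notin> \<rat> \<and> irrationality_exponent y = ereal \<kappa> \<longrightarrow>
         (\<forall>s\<in>{1..<10}. (\<lambda>N. stick_cdf p L N s - log 10 s) \<in> O(\<lambda>N. real N powr (- \<eta>)))))"
proof (rule conjI[OF _ conjI]; intro allI impI)
  fix p L :: real
  assume pL: "0 < p \<and> p < 1 \<and> 0 < L"
  fix N
  have "card (stick_length p L N ` {1..N + 1}) = N + 1" if "p \<noteq> 1 / 2"
  proof -
    have "inj_on (stick_length p L N) {1..N + 1}"
      by (rule inj_on_stick_length) (use pL that in auto)
    then show ?thesis
      by (metis card_image card_atLeastAtMost diff_Suc_1 Suc_eq_plus1)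
  qed
  moreover have "sticks p L N =
      (\<Sum>n = 1..N + 1. replicate_mset (N choose (n - 1)) (stick_length p L N n))"
    unfolding sum_1_shift by (simp add: sticks_eq)
  ultimately show "size (sticks p L N) = 2 ^ N \<and>
      sticks p L N =
        (\<Sum>n = 1..N + 1. replicate_mset (N choose (n - 1)) (stick_length p L N n)) \<and>
      (p \<noteq> 1 / 2 \<longrightarrow> card (stick_length p L N ` {1..N + 1}) = N + 1)"
    using size_sticks by blast
next
  fix p L y :: real
  assume "0 < p \<and> p < 1 \<and> 0 < L \<and> 10 powr y = (1 - p) / p"
  then have cdf: "stick_cdf p L N s =
      binomial_mean N (\<lambda>k. of_bool (frac ((log 10 L + real N * log 10 p) + real k * y) \<le> log 10 s))"
    if "s \<in> {1..<10}" for s N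
    using that by (intro stick_cdf_eq) auto
  show "(\<forall>s\<in>{1..<10}. (\<lambda>N. stick_cdf p L N s) \<longlonglongrightarrow> log 10 s) \<longleftrightarrow> y \<notin> \<rat>"
  proof
    assume lim: "\<forall>s\<in>{1..<10}. (\<lambda>N. stick_cdf p L N s) \<longlonglongrightarrow> log 10 s"
    show "y \<notin> \<rat>"
    proof
      assume "y \<in> \<rat>"
      from rational_imp_not_binomial_mean_tendsto[OF this, of "\<lambda>N. log 10 L + real N * log 10 p"]
      obtain t where t: "0 \<le> t" "t < 1" and nlim: "\<not> (\<lambda>N. binomial_mean N
          (\<lambda>k. of_bool (frac ((log 10 L + real N * log 10 p) + real k * y) \<le> t))) \<longlonglongrightarrow> t"
        by auto
      \<comment> \<open>Every \<open>t\<close> in \<open>[0, 1)\<close> is the logarithm of an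
        admissible \<open>s\<close>, so the failure at \<open>t\<close> contradicts convergence at
        \<open>s = 10 powr t\<close>.\<close>
      have s: "10 powr t \<in> {1..<10}"
        using t powr_less_mono[of t 1 10] by (auto simp: ge_one_powr_ge_zero)
      with lim have "(\<lambda>N. stick_cdf p L N (10 powr t)) \<longlonglongrightarrow> log 10 (10 powr t)"
        by blast
      with nlim cdf[OF s] show False
        by simp
    qed
  next
    assume "y \<notin> \<rat>"
    then show "\<forall>s\<in>{1..<10}. (\<lambda>N. stick_cdf p L N s) \<longlonglongrightarrow> log 10 s"
      by (auto simp: cdf intro!: irrational_imp_binomial_mean_tendsto)
  qed
next
  fix \<kappa> :: real
  \<comment> \<open>A value strictly above \<open>\<kappa>\<close> and at least 1, as
    \<open>binomial_mean_frac_rate\<close> requires. It is fixed before \<open>p\<close>,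
    \<open>L\<close> and \<open>y\<close>, so the resulting exponent depends on
    \<open>\<kappa>\<close> alone.\<close>
  define \<gamma> where "\<gamma> = max \<kappa> 1 + 1"
  have \<gamma>: "\<gamma> \<ge> 1" "\<kappa> < \<gamma>" by (auto simp: \<gamma>_def)
  show "\<exists>\<eta> :: real. \<eta> > 0 \<and>
      (\<forall>p L y :: real. 0 < p \<and> p < 1 \<and> 0 < L \<and> 10 powr y = (1 - p) / p \<and>
         y \<notin> \<rat> \<and> irrationality_exponent y = ereal \<kappa> \<longrightarrow>
         (\<forall>s\<in>{1..<10}. (\<lambda>N. stick_cdf p L N s - log 10 s) \<in> O(\<lambda>N. real N powr (- \<eta>))))"
  proof (intro exI[of _ "1 / (4 * \<gamma>)"] conjI allI impI ballI, goal_cases)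
    case 1
    show ?case using \<gamma> by simp
  next
    case (2 p L y s)
    then have "(\<lambda>N. stick_cdf p L N s) = (\<lambda>N. binomial_mean N
        (\<lambda>k. of_bool (frac ((log 10 L + real N * log 10 p) + real k * y) \<le> log 10 s)))"
      by (intro ext stick_cdf_eq) auto
    with 2 \<gamma> show ?case
      by (auto intro!: binomial_mean_frac_rate simp: fun_eq_iff)
  qed
qed

end
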